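(* Let $\mathbb{K}\in\{\mathbb{R},\mathbb{C}\}$, let $\mathcal{T}\in\mathbb{K}^{I_1\times I_2\times I_3}$ be a three-way tensor and let $\phi(\mathcal{T})$ be a rank-1 approximation of $\mathcal{T}$ (i.e. a rank-1 tensor of the same size). If $\phi(\mathcal{T})$ is the input of the CE (coupled-eigenvalue) algorithm and $\phi^\star(\mathcal{T})$ is its output, then $$\|\mathcal{T}-\phi^\star(\mathcal{T})\|\le\|\mathcal{T}-\phi(\mathcal{T})\|.$$
   Context: Notation. $\|\cdot\|$ is the Frobenius norm, $^*$ on vectors and matrices is entrywise conjugation, $^H$ conjugate transpose, $\boxtimes$ the Kronecker product, $\otimes$ the tensor (outer) product, and $\langle a,b\rangle=\sum_i a_ib_i^*$. For $1\le i_3\le I_3$, $t_{i_3}=\operatorname{vec}(\mathcal{T}(:,:,i_3))\in\mathbb{K}^{I_1I_2}$ is the column-stacking vectorization of the $i_3$-th slice, and $M=\sum_{i_3=1}^{I_3}t_{i_3}t_{i_3}^H$. Coupled eigenvalue problems. Writing $M=\sum_{r=1}^{R'}Q^{(r)}\boxtimes P^{(r)}$ with Hermitian $P^{(r)}\in\mathbb{K}^{I_1\times I_1}$ and $Q^{(r)}\in\mathbb{K}^{I_2\times I_2}$, define for vectors $y\in\mathbb{K}^{I_2}$ and $x\in\mathbb{K}^{I_1}$ the Hermitian matrices $$G(y)=\sum_{r=1}^{R'}(y^HQ^{(r)*}y)\,P^{(r)}\in\mathbb{K}^{I_1\times I_1},\qquad H(x)=\sum_{r=1}^{R'}(x^HP^{(r)}x)\,Q^{(r)*}\in\mathbb{K}^{I_2\times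 I_2}.$$ Independently of any decomposition of $M$, these matrices are $G(y)=(y^*\boxtimes I)^HM(y^*\boxtimes I)=\sum_{k}T_ky y^HT_k^H$ and $H(x)=\big((I\boxtimes x)^HM(I\boxtimes x)\big)^*=\sum_kT_k^Hxx^HT_k$, where $T_k=\mathcal{T}(:,:,k)$; these formulas may be taken as the definition. The two eigenvalue problems are $G(y)x=\lambda x$ and $H(x)y=\lambda y$. CE algorithm. Input: a rank-1 tensor $\phi(\mathcal{T})\in\mathbb{K}^{I_1\times I_2\times I_3}$. Choose $i_2,i_3$ with $\phi(\mathcal{T})(:,i_2,i_3)\ne0$ and set $x_0=\phi(\mathcal{T})(:,i_2,i_3)/\|\phi(\mathcal{T})(:,i_2,i_3)\|_2$. Starting from $t=0$, repeat (at least once) until some stopping criterion holds: let $y_{t+1}$ be a unit eigenvector of $H(x_t)$ for its largest eigenvalue, let $x_{t+1}$ be a unit eigenvector of $G(y_{t+1})$ for its largest eigenvalue, and increase $t$ by one. With $t\ge1$ the final index, set $\alpha^\star_{i_3}=\langle t_{i_3},\,y_t^*\boxtimes x_t\rangle$ for $1\le i_3\le I_3$, $\alpha^\star=(\alpha^\star_1,\dots,\alpha^\star_{I_3})$, and output $\phi^\star(\mathcal{T})=x_t\otimes y_t^*\otimes\alpha^\star$. *)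

theory Defs
  imports "HOL-Analysis.Analysis"
begin

(* The scalar field is a set K of complex numbers, either \<real> or UNIV. A tensor over K with
   dimensions I1, I2, I3 = CARD('a), CARD('b), CARD('c) is an element T of complex ^ 'c ^ 'b ^ 'a
   with entries T $ i1 $ i2 $ i3 in K; the library norm of this iterated vector type is the
   Frobenius norm. *)

definition kvecs :: "complex set \<Rightarrow> (complex ^ 'n) set" where
  "kvecs K = {v. \<forall>i. v $ i \<in> K}"

definition ktensors :: "complex set \<Rightarrow> (complex ^ 'c ^ 'b ^ 'a) set" where
  "ktensors K = {T. \<forall>i j k. T $ i $ j $ k \<in> K}"

definition vcnj :: "complex ^ 'n \<Rightarrow> complex ^ 'n" where
  "vcnj v = (\<chi> i. cnj (v $ i))"

definition mcnj :: "complex ^ 'n ^ 'm \<Rightarrow> complex ^ 'n ^ 'm" where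
  "mcnj A = (\<chi> i j. cnj (A $ i $ j))"

definition ctranspose :: "complex ^ 'n ^ 'm \<Rightarrow> complex ^ 'm ^ 'n" where
  "ctranspose A = transpose (mcnj A)"

definition cdot :: "complex ^ 'n \<Rightarrow> complex ^ 'n \<Rightarrow> complex" where
  "cdot a b = (\<Sum>i\<in>UNIV. a $ i * cnj (b $ i))"

definition outer :: "complex ^ 'm \<Rightarrow> complex ^ 'n \<Rightarrow> complex ^ 'n ^ 'm" where
  "outer u v = (\<chi> i j. u $ i * v $ j)"

definition outer3 :: "complex ^ 'a \<Rightarrow> complex ^ 'b \<Rightarrow> complex ^ 'c \<Rightarrow> complex ^ 'c ^ 'b ^ 'a" where
  "outer3 u v w = (\<chi> i j k. u $ i * v $ j * w $ k)"

definition rank_one :: "complex set \<Rightarrow> complex ^ 'c ^ 'b ^ 'a \<Rightarrow> bool" where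
  "rank_one K T \<longleftrightarrow>
     (\<exists>u\<in>kvecs K. \<exists>v\<in>kvecs K. \<exists>w\<in>kvecs K. u \<noteq> 0 \<and> v \<noteq> 0 \<and> w \<noteq> 0 \<and> T = outer3 u v w)"

(* Kronecker products are indexed by pairs, the index of the left factor first; in the
   lexicographic order this is the usual block layout. Vectors are treated as one-column matrices,
   whence the separate versions with a vector factor. *)

definition kron :: "complex ^ 'n ^ 'm \<Rightarrow> complex ^ 'q ^ 'p \<Rightarrow> complex ^ ('n \<times> 'q) ^ ('m \<times> 'p)" where
  "kron A B = (\<chi> r s. A $ fst r $ fst s * B $ snd r $ snd s)"

definition kron_vec :: "complex ^ 'm \<Rightarrow> complex ^ 'p \<Rightarrow> complex ^ ('m \<times> 'p)" where
  "kron_vec u v = (\<chi> r. u $ fst r * v $ snd r)"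

definition kron_vec_mat :: "complex ^ 'm \<Rightarrow> complex ^ 'q ^ 'p \<Rightarrow> complex ^ 'q ^ ('m \<times> 'p)" where
  "kron_vec_mat u B = (\<chi> r s. u $ fst r * B $ snd r $ s)"

definition kron_mat_vec :: "complex ^ 'n ^ 'm \<Rightarrow> complex ^ 'p \<Rightarrow> complex ^ 'n ^ ('m \<times> 'p)" where
  "kron_mat_vec A v = (\<chi> r s. A $ fst r $ s * v $ snd r)"

definition slice :: "complex ^ 'c ^ 'b ^ 'a \<Rightarrow> 'c \<Rightarrow> complex ^ 'b ^ 'a" where
  "slice T k = (\<chi> i j. T $ i $ j $ k)"

(* Column stacking: the row index is the fast (second) component of the pair. *)
definition vec_cols :: "complex ^ 'b ^ 'a \<Rightarrow> complex ^ ('b \<times> 'a)" where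
  "vec_cols A = (\<chi> p. A $ snd p $ fst p)"

definition tvec :: "complex ^ 'c ^ 'b ^ 'a \<Rightarrow> 'c \<Rightarrow> complex ^ ('b \<times> 'a)" where
  "tvec T k = vec_cols (slice T k)"

definition Mmat :: "complex ^ 'c ^ 'b ^ 'a \<Rightarrow> complex ^ ('b \<times> 'a) ^ ('b \<times> 'a)" where
  "Mmat T = (\<Sum>k\<in>UNIV. outer (tvec T k) (vcnj (tvec T k)))"

definition Gmat :: "complex ^ 'c ^ 'b ^ 'a \<Rightarrow> complex ^ 'b \<Rightarrow> complex ^ 'a ^ 'a" where
  "Gmat T y = ctranspose (kron_vec_mat (vcnj y) (mat 1)) ** Mmat T ** kron_vec_mat (vcnj y) (mat 1)"

definition Hmat :: "complex ^ 'c ^ 'b ^ 'a \<Rightarrow> complex ^ 'a \<Rightarrow> complex ^ 'b ^ 'b" where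
  "Hmat T x = mcnj (ctranspose (kron_mat_vec (mat 1) x) ** Mmat T ** kron_mat_vec (mat 1) x)"

lemma sum_UNIV_pair:
  "(\<Sum>p\<in>(UNIV :: ('m::finite \<times> 'n::finite) set). f p) = (\<Sum>i\<in>UNIV. \<Sum>j\<in>UNIV. f (i, j))"
  by (simp add: sum.cartesian_product)

lemma Gmat_nth:
  "Gmat T y $ a $ b = (\<Sum>j'\<in>UNIV. \<Sum>j\<in>UNIV. y $ j * Mmat T $ (j, a) $ (j', b) * cnj (y $ j'))"
proof -
  have 1: "(\<Sum>i\<in>UNIV. c * cnj (if i = a then 1 else 0) * z i * w) = c * z a * w"
    for c w and z :: "_ \<Rightarrow> complex"
    by (subst sum.remove[of _ a]) (auto intro!: sum.neutral)
  have 2: "(\<Sum>i\<in>UNIV. \<Sum>j\<in>UNIV. f i j * (c * (if i = b then 1 else 0))) = (\<Sum>j\<in>UNIV. f b j * c)"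
    for c and f :: "_ \<Rightarrow> _ \<Rightarrow> complex"
    by (subst sum.remove[of _ b]) (auto intro!: sum.neutral)
  show ?thesis
    by (simp add: Gmat_def matrix_matrix_mult_def ctranspose_def transpose_def mcnj_def
        kron_vec_mat_def vcnj_def mat_def sum_UNIV_pair 1 2 sum_distrib_right)
qed

lemma Hmat_nth:
  "Hmat T x $ a $ b = cnj (\<Sum>i'\<in>UNIV. \<Sum>i\<in>UNIV. cnj (x $ i) * Mmat T $ (a, i) $ (b, i') * x $ i')"
proof -
  have 1: "(\<Sum>j\<in>UNIV. \<Sum>i\<in>UNIV. cnj (if j = a then 1 else 0) * cnj (x $ i) * z j i * w)
      = (\<Sum>i\<in>UNIV. cnj (x $ i) * z a i * w)" for w and z :: "_ \<Rightarrow> _ \<Rightarrow> complex"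
    by (subst sum.remove[of _ a]) (auto intro!: sum.neutral)
  have 2: "(\<Sum>j\<in>UNIV. \<Sum>i\<in>UNIV. \<Sum>k\<in>UNIV. f j i k * ((if j = b then 1 else 0) * x $ i))
      = (\<Sum>i\<in>UNIV. \<Sum>k\<in>UNIV. f b i k * x $ i)" for f :: "_ \<Rightarrow> _ \<Rightarrow> _ \<Rightarrow> complex"
    by (subst sum.remove[of _ b]) (auto intro!: sum.neutral)
  show ?thesis
    by (simp add: Hmat_def matrix_matrix_mult_def ctranspose_def transpose_def mcnj_def
        kron_mat_vec_def mat_def sum_UNIV_pair 1 2 sum_distrib_right del: cnj_sum)
qed

lemma Mmat_nth: "Mmat T $ (j, a) $ (j', b) = (\<Sum>k\<in>UNIV. T $ a $ j $ k * cnj (T $ b $ j' $ k))"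
  by (simp add: Mmat_def outer_def tvec_def vec_cols_def slice_def vcnj_def)

lemma Gmat_slices:
  "Gmat T y = (\<Sum>k\<in>UNIV. slice T k ** outer y (vcnj y) ** ctranspose (slice T k))"
proof -
  have "Gmat T y $ a $ b
      = (\<Sum>k\<in>UNIV. slice T k ** outer y (vcnj y) ** ctranspose (slice T k)) $ a $ b" for a b
  proof -
    have "Gmat T y $ a $ b = (\<Sum>j'\<in>UNIV. \<Sum>j\<in>UNIV. \<Sum>k\<in>UNIV.
        T $ a $ j $ k * (y $ j * cnj (y $ j')) * cnj (T $ b $ j' $ k))"
      by (simp add: Gmat_nth Mmat_nth sum_distrib_left sum_distrib_right mult_ac)
    also have "\<dots> = (\<Sum>j'\<in>UNIV. \<Sum>k\<in>UNIV. \<Sum>j\<in>UNIV.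
        T $ a $ j $ k * (y $ j * cnj (y $ j')) * cnj (T $ b $ j' $ k))"
      by (rule sum.cong[OF refl], rule sum.swap)
    also have "\<dots> = (\<Sum>k\<in>UNIV. \<Sum>j'\<in>UNIV. \<Sum>j\<in>UNIV.
        T $ a $ j $ k * (y $ j * cnj (y $ j')) * cnj (T $ b $ j' $ k))"
      by (rule sum.swap)
    finally show ?thesis
      by (simp add: matrix_matrix_mult_def ctranspose_def transpose_def mcnj_def slice_def
          outer_def vcnj_def sum_distrib_right)
  qed
  then show ?thesis by (simp add: vec_eq_iff)
qed

lemma Hmat_slices:
  "Hmat T x = (\<Sum>k\<in>UNIV. ctranspose (slice T k) ** outer x (vcnj x) ** slice T k)"
proof -
  have "Hmat T x $ a $ b
      = (\<Sum>k\<in>UNIV. ctranspose (slice T k) ** outer x (vcnj x) ** slice T k) $ a $ b" for a b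
  proof -
    have "Hmat T x $ a $ b = (\<Sum>j'\<in>UNIV. \<Sum>j\<in>UNIV. \<Sum>k\<in>UNIV.
        cnj (T $ j $ a $ k) * (x $ j * cnj (x $ j')) * T $ j' $ b $ k)"
      by (simp add: Hmat_nth Mmat_nth sum_distrib_left sum_distrib_right mult_ac)
    also have "\<dots> = (\<Sum>j'\<in>UNIV. \<Sum>k\<in>UNIV. \<Sum>j\<in>UNIV.
        cnj (T $ j $ a $ k) * (x $ j * cnj (x $ j')) * T $ j' $ b $ k)"
      by (rule sum.cong[OF refl], rule sum.swap)
    also have "\<dots> = (\<Sum>k\<in>UNIV. \<Sum>j'\<in>UNIV. \<Sum>j\<in>UNIV.
        cnj (T $ j $ a $ k) * (x $ j * cnj (x $ j')) * T $ j' $ b $ k)"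
      by (rule sum.swap)
    finally show ?thesis
      by (simp add: matrix_matrix_mult_def ctranspose_def transpose_def mcnj_def slice_def
          outer_def vcnj_def sum_distrib_right)
  qed
  then show ?thesis by (simp add: vec_eq_iff)
qed

(* The scalar y^H B y is cdot (B *v y) y. *)

lemma Gmat_kron_sum:
  assumes M: "Mmat T = (\<Sum>r\<in>R. kron (Q r) (P r))"
    and Q: "\<And>r. r \<in> R \<Longrightarrow> ctranspose (Q r) = Q r"
  shows "Gmat T y = (\<Sum>r\<in>R. \<chi> a b. cdot (mcnj (Q r) *v y) y * P r $ a $ b)"
proof -
  have h: "cnj (Q r $ j $ j') = Q r $ j' $ j" if "r \<in> R" for r j j'
    using arg_cong[OF Q[OF that], of "\<lambda>A. A $ j' $ j"]
    by (simp add: ctranspose_def transpose_def mcnj_def)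
  have "Gmat T y $ a $ b = (\<Sum>r\<in>R. cdot (mcnj (Q r) *v y) y * P r $ a $ b)" for a b
  proof -
    have "Gmat T y $ a $ b = (\<Sum>j'\<in>UNIV. \<Sum>j\<in>UNIV. \<Sum>r\<in>R.
        Q r $ j $ j' * y $ j * cnj (y $ j') * P r $ a $ b)"
      by (simp add: Gmat_nth M kron_def sum_distrib_left sum_distrib_right mult_ac)
    also have "\<dots> = (\<Sum>j'\<in>UNIV. \<Sum>r\<in>R. \<Sum>j\<in>UNIV.
        Q r $ j $ j' * y $ j * cnj (y $ j') * P r $ a $ b)"
      by (rule sum.cong[OF refl], rule sum.swap)
    also have "\<dots> = (\<Sum>r\<in>R. \<Sum>j'\<in>UNIV. \<Sum>j\<in>UNIV.
        Q r $ j $ j' * y $ j * cnj (y $ j') * P r $ a $ b)"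
      by (rule sum.swap)
    finally show ?thesis
      by (simp add: cdot_def matrix_vector_mult_def mcnj_def h sum_distrib_right)
  qed
  then show ?thesis by (simp add: vec_eq_iff)
qed

lemma Hmat_kron_sum:
  assumes M: "Mmat T = (\<Sum>r\<in>R. kron (Q r) (P r))"
    and P: "\<And>r. r \<in> R \<Longrightarrow> ctranspose (P r) = P r"
  shows "Hmat T x = (\<Sum>r\<in>R. \<chi> a b. cdot (P r *v x) x * mcnj (Q r) $ a $ b)"
proof -
  have h: "cnj (P r $ j $ j') = P r $ j' $ j" if "r \<in> R" for r j j'
    using arg_cong[OF P[OF that], of "\<lambda>A. A $ j' $ j"]
    by (simp add: ctranspose_def transpose_def mcnj_def)
  have "Hmat T x $ a $ b = (\<Sum>r\<in>R. cdot (P r *v x) x * mcnj (Q r) $ a $ b)" for a b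
  proof -
    have "Hmat T x $ a $ b = (\<Sum>j'\<in>UNIV. \<Sum>j\<in>UNIV. \<Sum>r\<in>R.
        cnj (P r $ j $ j') * x $ j * cnj (x $ j') * cnj (Q r $ a $ b))"
      by (simp add: Hmat_nth M kron_def sum_distrib_left sum_distrib_right mult_ac)
    also have "\<dots> = (\<Sum>j'\<in>UNIV. \<Sum>r\<in>R. \<Sum>j\<in>UNIV.
        cnj (P r $ j $ j') * x $ j * cnj (x $ j') * cnj (Q r $ a $ b))"
      by (rule sum.cong[OF refl], rule sum.swap)
    also have "\<dots> = (\<Sum>r\<in>R. \<Sum>j'\<in>UNIV. \<Sum>j\<in>UNIV.
        cnj (P r $ j $ j') * x $ j * cnj (x $ j') * cnj (Q r $ a $ b))"
      by (rule sum.swap)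
    finally show ?thesis
      by (simp add: cdot_def matrix_vector_mult_def mcnj_def h sum_distrib_right)
  qed
  then show ?thesis by (simp add: vec_eq_iff)
qed

definition eigenpair :: "complex set \<Rightarrow> complex ^ 'n ^ 'n \<Rightarrow> complex \<Rightarrow> complex ^ 'n \<Rightarrow> bool" where
  "eigenpair K A l v \<longleftrightarrow> l \<in> K \<and> v \<in> kvecs K \<and> v \<noteq> 0 \<and> A *v v = l *s v"

(* Used for Hermitian matrices only, all of whose eigenvalues are real. *)
definition unit_top_eigenvector :: "complex set \<Rightarrow> complex ^ 'n ^ 'n \<Rightarrow> complex ^ 'n \<Rightarrow> bool" where
  "unit_top_eigenvector K A v \<longleftrightarrow> norm v = 1 \<and>
     (\<exists>l::real. eigenpair K A (of_real l) v \<and>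
        (\<forall>m::real. (\<exists>w. eigenpair K A (of_real m) w) \<longrightarrow> m \<le> l))"

definition CE_init :: "complex ^ 'c ^ 'b ^ 'a \<Rightarrow> complex ^ 'a \<Rightarrow> bool" where
  "CE_init F x0 \<longleftrightarrow>
     (\<exists>j k. let f = (\<chi> i. F $ i $ j $ k) in f \<noteq> 0 \<and> x0 = (1 / norm f) *\<^sub>R f)"

(* The algorithm is nondeterministic: the fibre used for x 0, each unit eigenvector, and the
   number n \<ge> 1 of iterations performed by the stopping criterion may be chosen arbitrarily. *)
definition CE_output ::
  "complex set \<Rightarrow> complex ^ 'c ^ 'b ^ 'a \<Rightarrow> complex ^ 'c ^ 'b ^ 'a \<Rightarrow> complex ^ 'c ^ 'b ^ 'a \<Rightarrow> bool" where
  "CE_output K T F F' \<longleftrightarrow>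
     (\<exists>(x :: nat \<Rightarrow> complex ^ 'a) (y :: nat \<Rightarrow> complex ^ 'b) n.
        n \<ge> 1 \<and> CE_init F (x 0) \<and>
        (\<forall>t<n. unit_top_eigenvector K (Hmat T (x t)) (y (Suc t)) \<and>
               unit_top_eigenvector K (Gmat T (y (Suc t))) (x (Suc t))) \<and>
        F' = outer3 (x n) (vcnj (y n)) (\<chi> k. cdot (tvec T k) (kron_vec (vcnj (y n)) (x n))))"

end

theory Submission
  imports Defs
begin

text \<open>
  For unit vectors \<open>x\<close>, \<open>y\<close> let \<open>contract T x y\<close> be the vector with entries \<open>x\<^sup>H T\<^sub>k y\<close>, and put
  \<open>J x y = (norm (contract T x y))\<^sup>2\<close>. The tensors \<open>x \<otimes> y\<^sup>* \<otimes> \<beta>\<close> with \<open>x\<close>, \<open>y\<close> fixed form a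
  subspace onto which \<open>T\<close> projects with coefficient vector \<open>\<beta> = contract T x y\<close>, so that by
  Pythagoras the smallest squared distance from \<open>T\<close> to such a tensor is \<open>(norm T)\<^sup>2 - J x y\<close>. The
  algorithm outputs exactly this minimiser, and the input can be written as \<open>x\<^sub>0 \<otimes> y\<^sub>0\<^sup>* \<otimes> \<beta>\<close>
  for some unit vector \<open>y\<^sub>0\<close> (\<open>norm_diff_outer3\<close>, \<open>CE_init_rank_one\<close>). It remains to see that \<open>J\<close> never
  decreases. But \<open>J x y\<close> is the quadratic form of \<open>H(x)\<close> at \<open>y\<close> and of \<open>G(y)\<close> at \<open>x\<close>, and by the
  Rayleigh principle a unit eigenvector for the largest eigenvalue maximises such a form over the
  unit sphere (\<open>rayleigh_le_top_eigenvector\<close>); hence \<open>J x\<^sub>t y\<^sub>t \<le> J x\<^sub>t y\<^sub>t\<^sub>+\<^sub>1 \<le> J x\<^sub>t\<^sub>+\<^sub>1 y\<^sub>t\<^sub>+\<^sub>1\<close>.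

  Everything is phrased with the real inner product, which is the real part of the Hermitian one.
  This treats both scalar fields at once: \<open>kvecs K\<close> is a real subspace of the complex vectors, on
  which the matrices act as self-adjoint real-linear maps.
\<close>

section \<open>The Rayleigh principle over the scalar field\<close>

text \<open>
  If the form \<open>f w \<bullet> w\<close> is maximal at \<open>w\<close> with value \<open>m\<close>, then \<open>g z = m *\<^sub>R z - f z\<close> is positive
  semidefinite on \<open>S\<close> with \<open>g w \<bullet> w = 0\<close>. Moving from \<open>w\<close> in the direction \<open>- g w\<close> would make the
  form of \<open>g\<close> negative to first order unless \<open>g w = 0\<close>.
\<close>

lemma selfadjoint_max_eigenvector:
  fixes f :: "'a::euclidean_space \<Rightarrow> 'a"
  assumes f: "linear f" and S: "subspace S"
    and fS: "\<And>z. z \<in> S \<Longrightarrow> f z \<in> S"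
    and sym: "\<And>w z. f w \<bullet> z = w \<bullet> f z"
    and u: "u \<in> S" "norm u = 1"
  obtains m w where "w \<in> S" "norm w = 1" "f w = m *\<^sub>R w" "f u \<bullet> u \<le> m"
proof -
  let ?U = "sphere 0 1 \<inter> S"
  have "compact ?U"
    using S by (intro compact_Int_closed compact_sphere closed_subspace)
  moreover have "?U \<noteq> {}" using u by auto
  moreover have "continuous_on ?U (\<lambda>w. f w \<bullet> w)"
    using f by (intro continuous_intros linear_continuous_on linear_conv_bounded_linear[THEN iffD1])
  ultimately obtain w where w: "w \<in> ?U" and max: "\<And>z. z \<in> ?U \<Longrightarrow> f z \<bullet> z \<le> f w \<bullet> w"
    using continuous_attains_sup[of ?U "\<lambda>w. f w \<bullet> w"] by blast
  define m where "m = f w \<bullet> w"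
  define g where "g z = m *\<^sub>R z - f z" for z
  have wS: "w \<in> S" and w1: "w \<bullet> w = 1" and nw: "norm w = 1"
    using w by (auto simp: dot_square_norm)
  have g: "linear g"
    unfolding g_def using f by (intro linear_compose_sub linear_scaleR)
  have gS: "g z \<in> S" if "z \<in> S" for z
    using S fS that by (simp add: g_def subspace_diff subspace_scale)
  have gsym: "g a \<bullet> z = a \<bullet> g z" for a z
    by (simp add: g_def inner_diff_left inner_diff_right sym)
  have pos: "0 \<le> g z \<bullet> z" if "z \<in> S" for z
  proof (cases "z = 0")
    case False
    have "(1 / norm z) *\<^sub>R z \<in> ?U"
      using S that False by (simp add: subspace_scale)
    from max[OF this] have "f z \<bullet> z / (norm z * norm z) \<le> m"
      by (simp add: linear_scale[OF f] m_def)
    then show ?thesis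
      using False by (simp add: g_def inner_diff_left divide_le_eq dot_square_norm power2_eq_square)
  qed simp
  have gw: "g w \<bullet> w = 0" by (simp add: g_def inner_diff_left w1 m_def)
  let ?a = "g w \<bullet> g w" and ?b = "g (g w) \<bullet> g w"
  have first_order: "2 * t * ?a \<le> t\<^sup>2 * ?b" for t
  proof -
    have "w - t *\<^sub>R g w \<in> S" using S wS gS by (simp add: subspace_diff subspace_scale)
    from pos[OF this] have "0 \<le> g (w - t *\<^sub>R g w) \<bullet> (w - t *\<^sub>R g w)" .
    also have "\<dots> = t\<^sup>2 * ?b - 2 * t * ?a"
      by (simp add: linear_diff[OF g] linear_scale[OF g] inner_diff_left inner_diff_right gw
          gsym[of "g w" w] power2_eq_square right_diff_distrib)
    finally show ?thesis by simp
  qed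
  have "?a = 0"
  proof (rule ccontr)
    assume "?a \<noteq> 0"
    then have a: "?a > 0" by (simp add: less_le)
    have b: "?b \<ge> 0" using pos[OF gS[OF wS]] .
    \<comment> \<open>Any \<open>t > 0\<close> with \<open>t * ?b < 2 * ?a\<close> would do; the summand 1 covers \<open>?b = 0\<close>.\<close>
    define t where "t = ?a / (?b + 1)"
    have t: "t > 0" using a b by (simp add: t_def)
    have "2 * ?a \<le> t * ?b"
      using first_order[of t] t by (simp add: power2_eq_square)
    also have "\<dots> \<le> ?a"
      using a b by (simp add: t_def divide_le_eq mult_left_mono)
    finally show False using a by simp
  qed
  then have "f w = m *\<^sub>R w" by (simp add: g_def)
  moreover have "f u \<bullet> u \<le> m" using max[of u] u by (simp add: m_def)
  ultimately show ?thesis using that wS nw by blast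
qed

lemma inner_eq_Re_cdot: "a \<bullet> b = Re (cdot a b)"
  by (simp add: inner_vec_def cdot_def inner_complex_def)

lemma subspace_kvecs: "K = \<real> \<or> K = UNIV \<Longrightarrow> subspace (kvecs K)"
  by (auto simp: subspace_def kvecs_def scaleR_conv_of_real[where 'a=complex]
      intro!: Reals_add Reals_mult)

lemma unit_top_eigenvector_in_kvecs: "unit_top_eigenvector K A v \<Longrightarrow> v \<in> kvecs K"
  by (auto simp: unit_top_eigenvector_def eigenpair_def)

text \<open>
  The hypothesis on \<open>v\<close> bounds only the eigenvalues that have an eigenvector over \<open>K\<close>. So the
  maximiser has to be found inside \<open>kvecs K\<close>, which is why \<open>selfadjoint_max_eigenvector\<close> is
  relative to an invariant subspace.
\<close>

lemma rayleigh_le_top_eigenvector: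
  fixes A :: "complex ^ 'n ^ 'n"
  assumes K: "K = \<real> \<or> K = UNIV"
    and A: "\<And>i j. A $ i $ j \<in> K"
    and sym: "\<And>w z. (A *v w) \<bullet> z = w \<bullet> (A *v z)"
    and v: "unit_top_eigenvector K A v"
    and u: "u \<in> kvecs K" "norm u = 1"
  shows "(A *v u) \<bullet> u \<le> (A *v v) \<bullet> v"
proof -
  have lin: "linear ((*v) A)"
    by (intro linearI) (simp_all add: vec_eq_iff matrix_vector_mult_def distrib_left sum.distrib
        scaleR_sum_right)
  have inv: "A *v z \<in> kvecs K" if "z \<in> kvecs K" for z
    using K that A
    by (auto simp: kvecs_def matrix_vector_mult_def intro!: sum_in_Reals Reals_mult)
  from selfadjoint_max_eigenvector[OF lin subspace_kvecs[OF K] inv sym u]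
  obtain m w where w: "w \<in> kvecs K" "norm w = 1" "A *v w = m *\<^sub>R w" and m: "(A *v u) \<bullet> u \<le> m"
    by metis
  have scale: "of_real r *s z = r *\<^sub>R z" for r :: real and z :: "complex ^ 'n"
    by (simp add: vec_eq_iff scaleR_conv_of_real[where 'a=complex])
  have "w \<noteq> 0" using w(2) by auto
  then have "eigenpair K A (of_real m) w"
    using w K by (auto simp: eigenpair_def scale)
  then obtain l where l: "eigenpair K A (of_real l) v" "m \<le> l" and nv: "norm v = 1"
    using v by (auto simp: unit_top_eigenvector_def)
  from l(1) nv have "(A *v v) \<bullet> v = l"
    by (simp add: eigenpair_def scale dot_square_norm)
  with l m show ?thesis by simp
qed

section \<open>The coupled matrices as Gram matrices of contractions\<close>

definition contract ::
  "complex ^ 'c ^ 'b ^ 'a \<Rightarrow> complex ^ 'a \<Rightarrow> complex ^ 'b \<Rightarrow> complex ^ 'c" where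
  "contract T x y = (\<chi> k. \<Sum>i\<in>UNIV. \<Sum>j\<in>UNIV. T $ i $ j $ k * cnj (x $ i) * y $ j)"

lemma Gmat_factor:
  "Gmat T y $ a $ b =
    (\<Sum>k\<in>UNIV. (\<Sum>j\<in>UNIV. T $ a $ j $ k * y $ j) * cnj (\<Sum>j\<in>UNIV. T $ b $ j $ k * y $ j))"
  by (simp add: Gmat_slices matrix_matrix_mult_def ctranspose_def transpose_def mcnj_def slice_def
      outer_def vcnj_def sum_distrib_right sum_distrib_left mult_ac)

lemma Hmat_factor:
  "Hmat T x $ a $ b =
    (\<Sum>k\<in>UNIV. cnj (\<Sum>i\<in>UNIV. T $ i $ a $ k * cnj (x $ i)) * (\<Sum>i\<in>UNIV. T $ i $ b $ k * cnj (x $ i)))"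
  by (simp add: Hmat_slices matrix_matrix_mult_def ctranspose_def transpose_def mcnj_def slice_def
      outer_def vcnj_def sum_distrib_right sum_distrib_left mult_ac)

lemma Gmat_entry_in:
  assumes "K = \<real> \<or> K = UNIV" "T \<in> ktensors K" "y \<in> kvecs K"
  shows "Gmat T y $ a $ b \<in> K"
  using assms
  by (auto simp: Gmat_factor ktensors_def kvecs_def Reals_cnj_iff
      intro!: sum_in_Reals Reals_mult)

lemma Hmat_entry_in:
  assumes "K = \<real> \<or> K = UNIV" "T \<in> ktensors K" "x \<in> kvecs K"
  shows "Hmat T x $ a $ b \<in> K"
  using assms
  by (auto simp: Hmat_factor ktensors_def kvecs_def Reals_cnj_iff
      intro!: sum_in_Reals Reals_mult)

text \<open>
  A matrix \<open>\<Sum>\<^sub>k p\<^sub>k p\<^sub>k\<^sup>H\<close> has the form \<open>\<Sum>\<^sub>k (p\<^sub>k\<^sup>H w) (p\<^sub>k\<^sup>H z)\<^sup>*\<close>. With \<open>p\<^sub>k = T\<^sub>k y\<close> or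
  \<open>p\<^sub>k = T\<^sub>k\<^sup>H x\<close> the factors are entries of contractions of \<open>T\<close>.
\<close>

lemma cdot_gram:
  fixes A :: "complex ^ 'n ^ 'n" and p :: "'k::finite \<Rightarrow> 'n \<Rightarrow> complex"
  assumes "\<And>a b. A $ a $ b = (\<Sum>k\<in>UNIV. p k a * cnj (p k b))"
  shows "cdot (A *v w) z =
    (\<Sum>k\<in>UNIV. (\<Sum>b\<in>UNIV. cnj (p k b) * w $ b) * cnj (\<Sum>a\<in>UNIV. cnj (p k a) * z $ a))"
proof -
  have "cdot (A *v w) z =
      (\<Sum>a\<in>UNIV. \<Sum>b\<in>UNIV. \<Sum>k\<in>UNIV. p k a * cnj (p k b) * w $ b * cnj (z $ a))"
    by (simp add: cdot_def matrix_vector_mult_def assms sum_distrib_right)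
  also have "\<dots> = (\<Sum>a\<in>UNIV. \<Sum>k\<in>UNIV. \<Sum>b\<in>UNIV. p k a * cnj (p k b) * w $ b * cnj (z $ a))"
    by (intro sum.cong[OF refl] sum.swap)
  also have "\<dots> = (\<Sum>k\<in>UNIV. \<Sum>a\<in>UNIV. \<Sum>b\<in>UNIV. p k a * cnj (p k b) * w $ b * cnj (z $ a))"
    by (rule sum.swap)
  finally show ?thesis
    by (simp add: sum_distrib_right sum_distrib_left mult_ac)
qed

lemma inner_Gmat: "(Gmat T y *v w) \<bullet> z = contract T w y \<bullet> contract T z y"
proof -
  define p where "p k a = (\<Sum>j\<in>UNIV. T $ a $ j $ k * y $ j)" for k a
  have *: "contract T v y $ k = cnj (\<Sum>a\<in>UNIV. cnj (p k a) * v $ a)" for v k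
    by (simp add: contract_def p_def sum_distrib_left sum_distrib_right mult_ac)
  have "cdot (Gmat T y *v w) z = cnj (cdot (contract T w y) (contract T z y))"
    by (subst cdot_gram[of _ p]) (simp_all add: Gmat_factor cdot_def * p_def)
  then show ?thesis by (simp add: inner_eq_Re_cdot)
qed

lemma inner_Hmat: "(Hmat T x *v w) \<bullet> z = contract T x w \<bullet> contract T x z"
proof -
  have *: "contract T x v $ k = (\<Sum>j\<in>UNIV. (\<Sum>i\<in>UNIV. T $ i $ j $ k * cnj (x $ i)) * v $ j)" for v k
    unfolding contract_def vec_lambda_beta sum_distrib_right by (rule sum.swap)
  have "cdot (Hmat T x *v w) z = cdot (contract T x w) (contract T x z)"
    by (subst cdot_gram[of _ "\<lambda>k a. cnj (\<Sum>i\<in>UNIV. T $ i $ a $ k * cnj (x $ i))"])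
      (simp_all only: Hmat_factor cdot_def * complex_cnj_cnj)
  then show ?thesis by (simp add: inner_eq_Re_cdot)
qed

text \<open>
  The matrices are real symmetric or Hermitian because \<open>inner_Hmat\<close> and \<open>inner_Gmat\<close> have right-hand
  sides symmetric in the two arguments; on the diagonal these are squared norms of contractions, so
  the Rayleigh principle compares contractions.
\<close>

lemma contract_le_y_step:
  assumes "K = \<real> \<or> K = UNIV" "T \<in> ktensors K" "x \<in> kvecs K"
    and "unit_top_eigenvector K (Hmat T x) y'" "y \<in> kvecs K" "norm y = 1"
  shows "norm (contract T x y) \<le> norm (contract T x y')"
proof -
  have "(Hmat T x *v y) \<bullet> y \<le> (Hmat T x *v y') \<bullet> y'"
    using assms by (intro rayleigh_le_top_eigenvector[of K] Hmat_entry_in)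
      (simp_all add: inner_Hmat inner_commute[of _ "Hmat T _ *v _"], simp_all add: inner_commute)
  then show ?thesis by (simp add: inner_Hmat norm_le)
qed

lemma contract_le_x_step:
  assumes "K = \<real> \<or> K = UNIV" "T \<in> ktensors K" "y \<in> kvecs K"
    and "unit_top_eigenvector K (Gmat T y) x'" "x \<in> kvecs K" "norm x = 1"
  shows "norm (contract T x y) \<le> norm (contract T x' y)"
proof -
  have "(Gmat T y *v x) \<bullet> x \<le> (Gmat T y *v x') \<bullet> x'"
    using assms by (intro rayleigh_le_top_eigenvector[of K] Gmat_entry_in)
      (simp_all add: inner_Gmat inner_commute[of _ "Gmat T _ *v _"], simp_all add: inner_commute)
  then show ?thesis by (simp add: inner_Gmat norm_le)
qed

section \<open>Distance to rank-one tensors\<close>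

lemma inner_outer3: "T \<bullet> outer3 x (vcnj y) b = contract T x y \<bullet> b"
proof -
  let ?s = "\<lambda>i j k. T $ i $ j $ k * cnj (x $ i) * y $ j * cnj (b $ k)"
  have "T \<bullet> outer3 x (vcnj y) b = Re (\<Sum>i\<in>UNIV. \<Sum>j\<in>UNIV. \<Sum>k\<in>UNIV. ?s i j k)"
    by (simp add: inner_vec_def outer3_def vcnj_def inner_complex_def algebra_simps)
  also have "(\<Sum>i\<in>UNIV. \<Sum>j\<in>UNIV. \<Sum>k\<in>UNIV. ?s i j k) =
      (\<Sum>i\<in>UNIV. \<Sum>k\<in>UNIV. \<Sum>j\<in>UNIV. ?s i j k)"
    by (intro sum.cong[OF refl] sum.swap)
  also have "\<dots> = (\<Sum>k\<in>UNIV. \<Sum>i\<in>UNIV. \<Sum>j\<in>UNIV. ?s i j k)"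
    by (rule sum.swap)
  also have "Re \<dots> = contract T x y \<bullet> b"
    by (simp add: inner_eq_Re_cdot cdot_def contract_def sum_distrib_right del: Re_sum)
  finally show ?thesis .
qed

lemma norm_vcnj [simp]: "norm (vcnj v) = norm v"
  by (simp add: norm_vec_def vcnj_def)

lemma norm_vec_scaled:
  fixes X :: "'a::real_normed_vector ^ 'n" and u :: "'b::real_normed_vector ^ 'n"
  assumes "\<And>i. norm (X $ i) = norm (u $ i) * c" "c \<ge> 0"
  shows "norm X = norm u * c"
  using assms by (simp add: norm_vec_def L2_set_left_distrib)

lemma norm_outer3: "norm (outer3 u v w) = norm u * norm v * norm w"
proof -
  have "norm (\<chi> k. c * w $ k) = norm w * norm c" for c :: complex
    by (rule norm_vec_scaled) (simp_all add: norm_mult)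
  then have "norm (\<chi> j k. c * v $ j * w $ k) = norm v * (norm c * norm w)" for c
    by (intro norm_vec_scaled) (simp_all add: norm_mult)
  then have "norm (outer3 u v w) = norm u * (norm v * norm w)"
    by (intro norm_vec_scaled) (simp_all add: outer3_def)
  then show ?thesis by simp
qed

text \<open>
  Pythagoras in the subspace of tensors \<open>x \<otimes> y\<^sup>* \<otimes> b\<close>: for unit \<open>x\<close>, \<open>y\<close> the map sending \<open>b\<close> to this
  tensor is an isometry, and \<open>inner_outer3\<close> says that its adjoint is the contraction.
\<close>

lemma norm_diff_outer3:
  assumes "norm x = 1" "norm y = 1"
  shows "(norm (T - outer3 x (vcnj y) b))\<^sup>2 =
    (norm T)\<^sup>2 - (norm (contract T x y))\<^sup>2 + (norm (contract T x y - b))\<^sup>2"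
proof -
  have expand: "(norm (p - q))\<^sup>2 = (norm p)\<^sup>2 - 2 * (p \<bullet> q) + (norm q)\<^sup>2" for p q :: "'z::real_inner"
    by (simp add: power2_norm_eq_inner inner_diff_left inner_diff_right inner_commute[of q p])
  have "norm (outer3 x (vcnj y) b) = norm b" using assms by (simp add: norm_outer3)
  then show ?thesis by (simp add: expand inner_outer3)
qed

lemma CE_coefficients:
  "(\<chi> k. cdot (tvec T k) (kron_vec (vcnj y) x)) = contract T x y"
proof -
  have "cdot (tvec T k) (kron_vec (vcnj y) x) = contract T x y $ k" for k
    unfolding contract_def vec_lambda_beta
    by (subst sum.swap) (simp add: cdot_def tvec_def vec_cols_def slice_def kron_vec_def vcnj_def
        sum_UNIV_pair mult_ac)
  then show ?thesis by (simp add: vec_eq_iff)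
qed

text \<open>
  Every fibre in the first mode of \<open>u \<otimes> v \<otimes> w\<close> is a multiple of \<open>u\<close>, so \<open>x\<^sub>0\<close> is a unit multiple
  of \<open>u\<close>, and the scalars can be moved into the third factor.
\<close>

lemma CE_init_rank_one:
  assumes K: "K = \<real> \<or> K = UNIV" and F: "rank_one K F" and x0: "CE_init F x0"
  obtains y0 b where "x0 \<in> kvecs K" "norm x0 = 1" "y0 \<in> kvecs K" "norm y0 = 1"
    "F = outer3 x0 (vcnj y0) b"
proof -
  from F obtain u v w where uvw: "u \<in> kvecs K" "v \<in> kvecs K" "w \<in> kvecs K" "v \<noteq> 0"
    and Fe: "F = outer3 u v w"
    by (auto simp: rank_one_def)
  from x0 obtain j k f where f: "f = (\<chi> i. F $ i $ j $ k)" "f \<noteq> 0" and x0e: "x0 = (1 / norm f) *\<^sub>R f"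
    by (auto simp: CE_init_def Let_def)
  define d where "d = of_real (1 / norm f) * (v $ j * w $ k)"
  have x0d: "x0 $ i = d * u $ i" for i
    by (simp add: x0e f(1) Fe outer3_def d_def scaleR_conv_of_real[where 'a=complex] mult_ac)
  have nx0: "norm x0 = 1" using f(2) by (simp add: x0e)
  have d: "d \<noteq> 0"
  proof
    assume "d = 0"
    then have "x0 = 0" by (simp add: vec_eq_iff x0d)
    with nx0 show False by simp
  qed
  have "d \<in> K"
    using K uvw by (auto simp: d_def kvecs_def intro!: Reals_mult Reals_divide)
  then have x0K: "x0 \<in> kvecs K" using K uvw(1) by (auto simp: kvecs_def x0d intro: Reals_mult)
  define y0 where "y0 = (1 / norm v) *\<^sub>R vcnj v"
  have "vcnj v \<in> kvecs K" using K uvw(2) by (auto simp: kvecs_def vcnj_def Reals_cnj_iff)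
  then have "y0 \<in> kvecs K"
    unfolding y0_def by (rule subspace_scale[OF subspace_kvecs[OF K]])
  moreover have "norm y0 = 1" using uvw(4) by (simp add: y0_def)
  moreover have "F = outer3 x0 (vcnj y0) (\<chi> k. of_real (norm v) / d * w $ k)"
    using uvw(4) d
    by (simp add: Fe outer3_def vec_eq_iff x0d y0_def vcnj_def
        scaleR_conv_of_real[where 'a=complex])
  ultimately show ?thesis using that x0K nx0 by blast
qed

section \<open>Monotonicity along the iteration\<close>

theorem mainTheorem2:
  fixes K :: "complex set"
    and T \<phi> \<phi>' :: "complex ^ 'c ^ 'b ^ 'a"
  assumes "K = \<real> \<or> K = UNIV"
    and "T \<in> ktensors K"
    and "rank_one K \<phi>"
    and "CE_output K T \<phi> \<phi>'"
  shows "norm (T - \<phi>') \<le> norm (T - \<phi>)"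
proof -
  note KT = assms(1,2)
  from assms(4) obtain x y n where n: "n \<ge> 1" and init: "CE_init \<phi> (x 0)"
    and y: "\<And>t. t < n \<Longrightarrow> unit_top_eigenvector K (Hmat T (x t)) (y (Suc t))"
    and x: "\<And>t. t < n \<Longrightarrow> unit_top_eigenvector K (Gmat T (y (Suc t))) (x (Suc t))"
    and out: "\<phi>' = outer3 (x n) (vcnj (y n)) (contract T (x n) (y n))"
    unfolding CE_output_def CE_coefficients by blast
  from CE_init_rank_one[OF KT(1) assms(3) init]
  obtain y0 b where x0: "x 0 \<in> kvecs K" "norm (x 0) = 1" and y0: "y0 \<in> kvecs K" "norm y0 = 1"
    and \<phi>: "\<phi> = outer3 (x 0) (vcnj y0) b"
    by blast
  \<comment> \<open>The algorithm never defines \<open>y 0\<close>; the unit vector from the input takes its place.\<close>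
  define y' where "y' = y(0 := y0)"
  have inv: "x t \<in> kvecs K \<and> norm (x t) = 1 \<and> y' t \<in> kvecs K \<and> norm (y' t) = 1 \<and>
      norm (contract T (x 0) y0) \<le> norm (contract T (x t) (y' t))" if "t \<le> n" for t
    using that
  proof (induction t)
    case 0
    then show ?case using x0 y0 by (simp add: y'_def)
  next
    case (Suc t)
    then have IH: "x t \<in> kvecs K" "norm (x t) = 1" "y' t \<in> kvecs K" "norm (y' t) = 1"
        "norm (contract T (x 0) y0) \<le> norm (contract T (x t) (y' t))" and t: "t < n"
      by auto
    note eig = y[OF t] x[OF t]
    note memb = eig[THEN unit_top_eigenvector_in_kvecs]
    have "norm (contract T (x t) (y' t)) \<le> norm (contract T (x t) (y (Suc t)))"
      using contract_le_y_step[OF KT IH(1) eig(1) IH(3,4)] .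
    also have "\<dots> \<le> norm (contract T (x (Suc t)) (y (Suc t)))"
      using contract_le_x_step[OF KT memb(1) eig(2) IH(1,2)] .
    finally show ?case
      using IH(5) memb eig by (simp add: y'_def unit_top_eigenvector_def)
  qed
  have yn: "y' n = y n" using n by (simp add: y'_def)
  have "(norm (T - \<phi>'))\<^sup>2 = (norm T)\<^sup>2 - (norm (contract T (x n) (y n)))\<^sup>2"
    using inv[of n] by (simp add: out yn norm_diff_outer3)
  also have "\<dots> \<le> (norm T)\<^sup>2 - (norm (contract T (x 0) y0))\<^sup>2"
    using inv[of n] by (simp add: yn power_mono)
  also have "\<dots> \<le> (norm (T - \<phi>))\<^sup>2"
    using x0 y0 by (simp add: \<phi> norm_diff_outer3)
  finally show ?thesis by (simp add: power2_le_iff_abs_le)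
qed

end
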